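(* Let $w_\ell<w_u$ be real numbers and let $\tilde q>0$, $k_0>0$ be such that $$\frac{\min\{k_0,1\}}{\sqrt2}\lambda>k_0^2\bigl(1+\tilde q\max\{-w_\ell,w_u\}\bigr).$$ Let $w\in W_{\mathrm{ad}}$ and let $u_h\in H^1(\Omega,\mathbb{C})$ solve $$\int_\Omega\nabla u_h\cdot\nabla\overline v-k_0^2\int_\Omega u_h\overline v-k_0^2\int_\Omega q(P_hw)(P_hu_h)\overline v-ik_0\int_{\partial\Omega}u_h\overline v=k_0^2\int_\Omega qwu_0\overline v\quad\text{for all }v\in H^1(\Omega,\mathbb{C}).$$ Then $$\|u_h\|_{L^\infty(\Omega,\mathbb{C})}\le\sqrt2\,c_3(\Omega)\,(c_1+c_1\bar c_2+\bar c_2)\,\|u_0\|_{L^2(\Omega,\mathbb{C})}.$$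
   Context: $\Omega\subset\mathbb{R}^2$ is an open square (so $n=2$). $W_{\mathrm{ad}}=\{w\in L^\infty(\Omega):w_\ell\le w\le w_u\text{ a.e.}\}$ (real-valued). $q=\tilde q\,1_{\tilde\Omega}$ for a measurable subset $\tilde\Omega\subset\Omega$; $u_0(x)=\exp(ik_0\,d\cdot x)$ with fixed $d\in\mathbb{R}^2$. Boundary integrals use traces. $\mathcal{Q}_h=\{Q_h^1,\dots,Q_h^{N_h}\}$ is a partition of $\Omega$ with mesh size $h$, and $P_hg=\sum_{i=1}^{N_h}1_{Q_h^i}\frac1{\operatorname{meas}Q_h^i}\int_{Q_h^i}g$ is local averaging. The partition is compatible with $\tilde\Omega$: $\tilde\Omega=\bigcup_{i\in I}Q_h^i$ for some $I\subset\{1,\dots,N_h\}$. $\|y\|_{H^1(\Omega,\mathbb{C})}^2=\|y\|_{L^2(\Omega,\mathbb{C})}^2+\|\nabla y\|_{L^2(\Omega,\mathbb{C}^2)}^2$, and $\lambda>0$ is a constant with $\sqrt\lambda\,\|y\|_{H^1(\Omega,\mathbb{C})}\le\sqrt{\|y\|_{L^2(\partial\Omega,\mathbb{C})}^2+\|\nabla y\|_{L^2(\Omega,\mathbb{C}^2)}^2}$ for all $y\in H^1(\Omega,\mathbb{C})$. $C(\Omega)>0$ denotes the constant, depending only on $\Omega$, of the known $H^2$-regularity estimate for the Helmholtz problem with Robin boundary conditions: for every $k>0$ and $g\in L^2(\Omega,\mathbb{C})$, the weak solution $y$ of $-\Delta y-k^2y=g$ in $\Omega$, $\partial_n y=\pm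 iky$ on $\partial\Omega$ (either sign) satisfies $|y|_{H^2(\Omega,\mathbb{C})}\le C(\Omega)(1+|k|)\|g\|_{L^2(\Omega,\mathbb{C})}$, where $|y|_{H^2(\Omega,\mathbb{C})}=\bigl(\sum_{i,j}\|\partial_{x_i}\partial_{x_j}y\|_{L^2(\Omega,\mathbb{C})}^2\bigr)^{1/2}$. $c_3(\Omega)$ is the embedding constant of $H^2(\Omega,\mathbb{C})\hookrightarrow L^\infty(\Omega,\mathbb{C})$, where $\|y\|_{H^2}^2=\|y\|_{H^1}^2+|y|_{H^2}^2$. Further, $c_1:=C(\Omega)(1+|k_0|)k_0^2\tilde q\max\{-w_\ell,w_u\}$ and $\bar c_2:=\bar c^{-1}k_0^2\tilde q\max\{-w_\ell,w_u\}$ with $\bar c:=\lambda\min\{k_0,1\}/\sqrt2-k_0^2(1+\tilde q\max\{-w_\ell,w_u\})$. *)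

theory Defs
  imports "HOL-Probability.Essential_Supremum"
begin

section \<open>Open squares and arc length on their boundary\<close>

text \<open>The square has corner \<open>p\<close> and sides \<open>e\<close>, \<open>f\<close>; it need not be axis-parallel.\<close>

definition open_square :: "real^2 \<Rightarrow> real^2 \<Rightarrow> real^2 \<Rightarrow> (real^2) set" where
  "open_square p e f = {p + s *\<^sub>R e + t *\<^sub>R f | s t. 0 < s \<and> s < 1 \<and> 0 < t \<and> t < 1}"

definition perimeter :: "real^2 \<Rightarrow> real^2 \<Rightarrow> real^2 \<Rightarrow> real \<Rightarrow> real^2" where
  "perimeter p e f t =
     (if t \<le> 1 then linepath p (p + e) t
      else if t \<le> 2 then linepath (p + e) (p + e + f) (t - 1)
      else if t \<le> 3 then linepath (p + e + f) (p + f) (t - 2)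
      else linepath (p + f) p (t - 3))"

text \<open>The perimeter is run through with constant speed \<open>norm e\<close>, hence the scaling factor.\<close>

definition perimeter_measure :: "real^2 \<Rightarrow> real^2 \<Rightarrow> real^2 \<Rightarrow> (real^2) measure" where
  "perimeter_measure p e f =
     scale_measure (ennreal (norm e)) (distr (lebesgue_on {0..4}) borel (perimeter p e f))"

text \<open>\<open>\<Omega>\<close> is an open square and \<open>S\<close> is the arc length measure on its boundary.\<close>

definition square_with_boundary :: "(real^2) set \<Rightarrow> (real^2) measure \<Rightarrow> bool" where
  "square_with_boundary \<Omega> S \<longleftrightarrow>
     (\<exists>p e f. e \<noteq> 0 \<and> norm e = norm f \<and> e \<bullet> f = 0 \<and>
        \<Omega> = open_square p e f \<and> S = perimeter_measure p e f)"


section \<open>Lebesgue spaces\<close>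

text \<open>Elements of function spaces are represented by functions on the whole plane; equality almost
  everywhere is not factored out.\<close>

definition L2 :: "'a measure \<Rightarrow> ('a \<Rightarrow> 'b::{banach, second_countable_topology}) set" where
  "L2 M = {f \<in> borel_measurable M. integrable M (\<lambda>x. (norm (f x))\<^sup>2)}"

definition L2_norm :: "'a measure \<Rightarrow> ('a \<Rightarrow> 'b::{banach, second_countable_topology}) \<Rightarrow> real" where
  "L2_norm M f = sqrt (LINT x|M. (norm (f x))\<^sup>2)"

text \<open>Extended-real valued: \<open>\<infinity>\<close> if \<open>f\<close> is not essentially bounded.\<close>

definition Linf_norm :: "'a measure \<Rightarrow> ('a \<Rightarrow> 'b::{banach, second_countable_topology}) \<Rightarrow> ereal" where
  "Linf_norm M f = esssup M (\<lambda>x. ereal (norm (f x)))"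

definition Linf :: "'a measure \<Rightarrow> ('a \<Rightarrow> 'b::{banach, second_countable_topology}) set" where
  "Linf M = {f \<in> borel_measurable M. Linf_norm M f < \<infinity>}"


section \<open>Weak derivatives and Sobolev spaces\<close>

primrec Ck :: "nat \<Rightarrow> ('a::euclidean_space \<Rightarrow> 'b::real_normed_vector) \<Rightarrow> bool" where
  "Ck 0 f \<longleftrightarrow> continuous_on UNIV f"
| "Ck (Suc n) f \<longleftrightarrow> (\<forall>x. f differentiable (at x)) \<and>
     (\<forall>b\<in>Basis. Ck n (\<lambda>x. frechet_derivative f (at x) b))"

definition smooth :: "('a::euclidean_space \<Rightarrow> 'b::real_normed_vector) \<Rightarrow> bool" where
  "smooth f \<longleftrightarrow> (\<forall>n. Ck n f)"

definition test_function :: "(real^2) set \<Rightarrow> (real^2 \<Rightarrow> real) \<Rightarrow> bool" where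
  "test_function \<Omega> \<phi> \<longleftrightarrow>
     smooth \<phi> \<and> compact (closure {x. \<phi> x \<noteq> 0}) \<and> closure {x. \<phi> x \<noteq> 0} \<subseteq> \<Omega>"

definition locally_integrable :: "(real^2) set \<Rightarrow> (real^2 \<Rightarrow> complex) \<Rightarrow> bool" where
  "locally_integrable \<Omega> u \<longleftrightarrow> (\<forall>K. compact K \<longrightarrow> K \<subseteq> \<Omega> \<longrightarrow> set_integrable lebesgue K u)"

definition has_weak_pderiv ::
    "(real^2) set \<Rightarrow> 2 \<Rightarrow> (real^2 \<Rightarrow> complex) \<Rightarrow> (real^2 \<Rightarrow> complex) \<Rightarrow> bool" where
  "has_weak_pderiv \<Omega> i u g \<longleftrightarrow> locally_integrable \<Omega> u \<and> locally_integrable \<Omega> g \<and>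
     (\<forall>\<phi>. test_function \<Omega> \<phi> \<longrightarrow>
        (LINT x|lebesgue_on \<Omega>. frechet_derivative \<phi> (at x) (axis i 1) *\<^sub>R u x) =
        - (LINT x|lebesgue_on \<Omega>. \<phi> x *\<^sub>R g x))"

text \<open>A chosen square-integrable representative; it is unique only up to null sets.\<close>

definition weak_pderiv :: "(real^2) set \<Rightarrow> 2 \<Rightarrow> (real^2 \<Rightarrow> complex) \<Rightarrow> (real^2 \<Rightarrow> complex)" where
  "weak_pderiv \<Omega> i u = (SOME g. g \<in> L2 (lebesgue_on \<Omega>) \<and> has_weak_pderiv \<Omega> i u g)"

definition weak_grad :: "(real^2) set \<Rightarrow> (real^2 \<Rightarrow> complex) \<Rightarrow> (real^2 \<Rightarrow> complex^2)" where
  "weak_grad \<Omega> u = (\<lambda>x. \<chi> i. weak_pderiv \<Omega> i u x)"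

definition H1 :: "(real^2) set \<Rightarrow> (real^2 \<Rightarrow> complex) set" where
  "H1 \<Omega> = {u \<in> L2 (lebesgue_on \<Omega>). \<forall>i. \<exists>g \<in> L2 (lebesgue_on \<Omega>). has_weak_pderiv \<Omega> i u g}"

definition H1_norm :: "(real^2) set \<Rightarrow> (real^2 \<Rightarrow> complex) \<Rightarrow> real" where
  "H1_norm \<Omega> u =
     sqrt ((L2_norm (lebesgue_on \<Omega>) u)\<^sup>2 + (L2_norm (lebesgue_on \<Omega>) (weak_grad \<Omega> u))\<^sup>2)"

definition H2 :: "(real^2) set \<Rightarrow> (real^2 \<Rightarrow> complex) set" where
  "H2 \<Omega> = {u \<in> H1 \<Omega>. \<forall>i. weak_pderiv \<Omega> i u \<in> H1 \<Omega>}"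

definition H2_seminorm :: "(real^2) set \<Rightarrow> (real^2 \<Rightarrow> complex) \<Rightarrow> real" where
  "H2_seminorm \<Omega> u =
     sqrt (\<Sum>i\<in>UNIV. \<Sum>j\<in>UNIV.
       (L2_norm (lebesgue_on \<Omega>) (weak_pderiv \<Omega> i (weak_pderiv \<Omega> j u)))\<^sup>2)"

definition H2_norm :: "(real^2) set \<Rightarrow> (real^2 \<Rightarrow> complex) \<Rightarrow> real" where
  "H2_norm \<Omega> u = sqrt ((H1_norm \<Omega> u)\<^sup>2 + (H2_seminorm \<Omega> u)\<^sup>2)"

text \<open>The trace is the continuous extension to \<open>H1 \<Omega>\<close> of the restriction of functions that are
  smooth up to the boundary; \<open>S\<close> is the measure on the boundary of \<open>\<Omega>\<close>.\<close>

definition has_trace ::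
    "(real^2) set \<Rightarrow> (real^2) measure \<Rightarrow> (real^2 \<Rightarrow> complex) \<Rightarrow> (real^2 \<Rightarrow> complex) \<Rightarrow> bool" where
  "has_trace \<Omega> S u g \<longleftrightarrow> u \<in> H1 \<Omega> \<and> g \<in> L2 S \<and>
     (\<exists>\<phi> :: nat \<Rightarrow> real^2 \<Rightarrow> complex. (\<forall>n. smooth (\<phi> n)) \<and>
        (\<lambda>n. H1_norm \<Omega> (\<lambda>x. \<phi> n x - u x)) \<longlonglongrightarrow> 0 \<and>
        (\<lambda>n. L2_norm S (\<lambda>x. \<phi> n x - g x)) \<longlonglongrightarrow> 0)"

definition bdry_trace ::
    "(real^2) set \<Rightarrow> (real^2) measure \<Rightarrow> (real^2 \<Rightarrow> complex) \<Rightarrow> (real^2 \<Rightarrow> complex)" where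
  "bdry_trace \<Omega> S u = (SOME g. has_trace \<Omega> S u g)"


section \<open>Constants of the domain\<close>

definition friedrichs_constant :: "(real^2) set \<Rightarrow> (real^2) measure \<Rightarrow> real \<Rightarrow> bool" where
  "friedrichs_constant \<Omega> S lam \<longleftrightarrow> lam > 0 \<and>
     (\<forall>y \<in> H1 \<Omega>. sqrt lam * H1_norm \<Omega> y \<le>
        sqrt ((L2_norm S (bdry_trace \<Omega> S y))\<^sup>2 + (L2_norm (lebesgue_on \<Omega>) (weak_grad \<Omega> y))\<^sup>2))"

text \<open>Weak solutions of \<open>- \<Delta> y - k\<^sup>2 y = g\<close> in \<open>\<Omega>\<close> with \<open>\<partial>\<^sub>n y = s \<i> k y\<close> on the boundary, where
  \<open>s\<close> is the sign \<open>1\<close> or \<open>-1\<close>.\<close>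

definition robin_helmholtz_solution ::
    "(real^2) set \<Rightarrow> (real^2) measure \<Rightarrow> real \<Rightarrow> real \<Rightarrow> (real^2 \<Rightarrow> complex) \<Rightarrow>
     (real^2 \<Rightarrow> complex) \<Rightarrow> bool" where
  "robin_helmholtz_solution \<Omega> S s k g y \<longleftrightarrow> y \<in> H1 \<Omega> \<and>
     (\<forall>v \<in> H1 \<Omega>.
        (LINT x|lebesgue_on \<Omega>. (\<Sum>i\<in>UNIV. weak_grad \<Omega> y x $ i * cnj (weak_grad \<Omega> v x $ i)))
        - of_real (k\<^sup>2) * (LINT x|lebesgue_on \<Omega>. y x * cnj (v x))
        - of_real s * \<i> * of_real k * (LINT x|S. bdry_trace \<Omega> S y x * cnj (bdry_trace \<Omega> S v x))
        = (LINT x|lebesgue_on \<Omega>. g x * cnj (v x)))"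

definition H2_regularity_constant :: "(real^2) set \<Rightarrow> (real^2) measure \<Rightarrow> real \<Rightarrow> bool" where
  "H2_regularity_constant \<Omega> S C \<longleftrightarrow> C > 0 \<and>
     (\<forall>k > 0. \<forall>g \<in> L2 (lebesgue_on \<Omega>). \<forall>s \<in> {1, -1}. \<forall>y.
        robin_helmholtz_solution \<Omega> S s k g y \<longrightarrow>
          y \<in> H2 \<Omega> \<and> H2_seminorm \<Omega> y \<le> C * (1 + \<bar>k\<bar>) * L2_norm (lebesgue_on \<Omega>) g)"

definition H2_Linf_embedding_constant :: "(real^2) set \<Rightarrow> real \<Rightarrow> bool" where
  "H2_Linf_embedding_constant \<Omega> c \<longleftrightarrow> c > 0 \<and>
     (\<forall>y \<in> H2 \<Omega>. Linf_norm (lebesgue_on \<Omega>) y \<le> ereal (c * H2_norm \<Omega> y))"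


section \<open>Controls, partitions and local averaging\<close>

definition W_ad :: "(real^2) set \<Rightarrow> real \<Rightarrow> real \<Rightarrow> (real^2 \<Rightarrow> real) set" where
  "W_ad \<Omega> wl wu =
     {w \<in> Linf (lebesgue_on \<Omega>). AE x in lebesgue_on \<Omega>. wl \<le> w x \<and> w x \<le> wu}"

text \<open>The cells have positive measure, so that averages over them make sense.\<close>

definition mesh :: "(real^2) set \<Rightarrow> real \<Rightarrow> (real^2) set set \<Rightarrow> bool" where
  "mesh \<Omega> h \<Q> \<longleftrightarrow> finite \<Q> \<and> partition_on \<Omega> \<Q> \<and>
     (\<forall>Q\<in>\<Q>. Q \<in> lmeasurable \<and> measure lebesgue Q > 0) \<and> h = Max (diameter ` \<Q>)"

definition local_avg :: "(real^2) set set \<Rightarrow>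
    (real^2 \<Rightarrow> 'b::{banach, second_countable_topology}) \<Rightarrow> (real^2 \<Rightarrow> 'b)" where
  "local_avg \<Q> g = (\<lambda>x. \<Sum>Q\<in>\<Q>.
     indicat_real Q x *\<^sub>R ((1 / measure lebesgue Q) *\<^sub>R (LINT y:Q|lebesgue. g y)))"

end

theory Submission
  imports Defs
begin

text \<open>Move the zeroth-order terms with the coefficient \<open>q\<close> to the right-hand side: \<open>u\<^sub>h\<close> then solves
  the Robin problem for the plain Helmholtz operator with the source
  \<open>g = k\<^sub>0\<^sup>2 (q (P\<^sub>h w) (P\<^sub>h u\<^sub>h) + q w u\<^sub>0)\<close>. Write \<open>K = \<tilde>q max {- w\<^sub>\<ell>, w\<^sub>u}\<close>. Averaging over
  cells does not increase the \<open>L\<^sup>2\<close> norm (\<open>local_avg_L2\<close>) and preserves the pointwise bound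
  \<open>\<bar>w\<bar> \<le> max {- w\<^sub>\<ell>, w\<^sub>u}\<close> (\<open>local_avg_bounded\<close>), so the \<open>L\<^sup>2\<close> norm of \<open>g\<close> is at most
  \<open>k\<^sub>0\<^sup>2 K (\<parallel>u\<^sub>h\<parallel> + \<parallel>u\<^sub>0\<parallel>)\<close>.

  Testing the equation with \<open>u\<^sub>h\<close> itself and using the Friedrichs inequality
  (\<open>robin_helmholtz_energy\<close>) bounds \<open>min {k\<^sub>0, 1} \<lambda> / \<surd>2\<close> times the squared \<open>H\<^sup>1\<close> norm by
  \<open>k\<^sub>0\<^sup>2 \<parallel>u\<^sub>h\<parallel>\<^sup>2 + \<parallel>g\<parallel> \<parallel>u\<^sub>h\<parallel>\<close>. The part of the right-hand side that is quadratic in \<open>u\<^sub>h\<close> is at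
  most \<open>k\<^sub>0\<^sup>2 (1 + K)\<close> times the squared \<open>H\<^sup>1\<close> norm. The smallness condition on \<open>k\<^sub>0\<close> says
  precisely that the left-hand side absorbs it with the positive constant \<open>cb\<close> left over, which
  gives \<open>\<parallel>u\<^sub>h\<parallel>\<^bsub>H1\<^esub> \<le> cb2 \<parallel>u\<^sub>0\<parallel>\<close>. Now \<open>g\<close> itself is controlled by \<open>u\<^sub>0\<close>, so the regularity
  estimate bounds the \<open>H\<^sup>2\<close> seminorm by \<open>c1 (cb2 + 1) \<parallel>u\<^sub>0\<parallel>\<close>. Adding the two bounds and applying
  the embedding into \<open>L\<^sup>\<infinity>\<close> finishes the argument.\<close>


section \<open>Square-integrable functions\<close>

lemma L2_normsq: "(L2_norm M f)\<^sup>2 = (LINT x|M. (norm (f x))\<^sup>2)"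
  unfolding L2_norm_def by (simp add: integral_nonneg)

lemma L2_norm_nonneg [simp]: "0 \<le> L2_norm M f"
  unfolding L2_norm_def by (simp add: integral_nonneg)

text \<open>This is the Cauchy--Schwarz inequality for nonnegative extended-real integrals, carried over
  to Bochner integrals. Integrability comes first, from \<open>a b \<le> a\<^sup>2 + b\<^sup>2\<close>; only then do the two
  integrals of the product agree.\<close>

lemma L2_Cauchy_Schwarz:
  assumes f: "f \<in> L2 M" and g: "g \<in> L2 M"
  shows "integrable M (\<lambda>x. norm (f x) * norm (g x))"
    and "(LINT x|M. norm (f x) * norm (g x)) \<le> L2_norm M f * L2_norm M g"
proof -
  have [measurable]: "f \<in> borel_measurable M" "g \<in> borel_measurable M"
    and fi: "integrable M (\<lambda>x. (norm (f x))\<^sup>2)" and gi: "integrable M (\<lambda>x. (norm (g x))\<^sup>2)"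
    using f g unfolding L2_def by auto
  have "norm (norm (f x) * norm (g x)) \<le> norm ((norm (f x))\<^sup>2 + (norm (g x))\<^sup>2)" for x
  proof -
    have "norm (f x) * norm (g x) \<le> (norm (f x))\<^sup>2 + (norm (g x))\<^sup>2"
      using sum_squares_bound[of "norm (f x)" "norm (g x)"]
        mult_nonneg_nonneg[OF norm_ge_zero norm_ge_zero, of "f x" "g x"] by linarith
    then show ?thesis by (simp add: abs_mult)
  qed
  then show int: "integrable M (\<lambda>x. norm (f x) * norm (g x))"
    by (intro Bochner_Integration.integrable_bound[OF Bochner_Integration.integrable_add[OF fi gi]])
      auto
  have "ennreal ((LINT x|M. norm (f x) * norm (g x))\<^sup>2)
      = (\<integral>\<^sup>+x. ennreal (norm (f x)) * ennreal (norm (g x)) \<partial>M)\<^sup>2"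
    using nn_integral_eq_integral[OF int]
    by (simp add: ennreal_mult ennreal_power integral_nonneg)
  also have "\<dots> \<le> (\<integral>\<^sup>+x. ennreal (norm (f x)) ^ 2 \<partial>M) * (\<integral>\<^sup>+x. ennreal (norm (g x)) ^ 2 \<partial>M)"
    by (rule Cauchy_Schwarz_nn_integral) measurable
  also have "\<dots> = ennreal ((L2_norm M f)\<^sup>2 * (L2_norm M g)\<^sup>2)"
    using nn_integral_eq_integral[OF fi] nn_integral_eq_integral[OF gi]
    by (simp add: L2_normsq ennreal_mult ennreal_power integral_nonneg)
  finally have "(LINT x|M. norm (f x) * norm (g x))\<^sup>2 \<le> (L2_norm M f * L2_norm M g)\<^sup>2"
    by (simp add: power_mult_distrib)
  then show "(LINT x|M. norm (f x) * norm (g x)) \<le> L2_norm M f * L2_norm M g"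
    by (rule power2_le_imp_le) simp
qed

lemma L2_mult_cnj:
  fixes f g :: "'a \<Rightarrow> complex"
  assumes f: "f \<in> L2 M" and g: "g \<in> L2 M"
  shows "integrable M (\<lambda>x. f x * cnj (g x))"
    and "cmod (LINT x|M. f x * cnj (g x)) \<le> L2_norm M f * L2_norm M g"
proof -
  have [measurable]: "f \<in> borel_measurable M" "g \<in> borel_measurable M"
    using f g unfolding L2_def by auto
  have [measurable]: "(\<lambda>x. cnj (g x)) \<in> borel_measurable M"
    by (rule borel_measurable_continuous_on[OF continuous_on_cnj[OF continuous_on_id]]) measurable
  show "integrable M (\<lambda>x. f x * cnj (g x))"
    by (rule Bochner_Integration.integrable_bound[OF L2_Cauchy_Schwarz(1)[OF f g]])
      (auto simp: norm_mult)
  have "cmod (LINT x|M. f x * cnj (g x)) \<le> (LINT x|M. norm (f x) * norm (g x))"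
    using integral_norm_bound[of M "\<lambda>x. f x * cnj (g x)"] by (simp add: norm_mult)
  with L2_Cauchy_Schwarz(2)[OF f g]
  show "cmod (LINT x|M. f x * cnj (g x)) \<le> L2_norm M f * L2_norm M g"
    by linarith
qed

text \<open>Minkowski's inequality for exponent 2: expand \<open>(\<bar>f\<bar> + \<bar>g\<bar>)\<^sup>2\<close> and estimate the mixed term by
  Cauchy--Schwarz.\<close>

lemma L2_add:
  assumes f: "f \<in> L2 M" and g: "g \<in> L2 M"
  shows "(\<lambda>x. f x + g x) \<in> L2 M"
    and "L2_norm M (\<lambda>x. f x + g x) \<le> L2_norm M f + L2_norm M g"
proof -
  have [measurable]: "f \<in> borel_measurable M" "g \<in> borel_measurable M"
    and fi: "integrable M (\<lambda>x. (norm (f x))\<^sup>2)" and gi: "integrable M (\<lambda>x. (norm (g x))\<^sup>2)"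
    using f g unfolding L2_def by auto
  let ?h = "\<lambda>x. (norm (f x))\<^sup>2 + (norm (g x))\<^sup>2 + 2 * (norm (f x) * norm (g x))"
  note fg = L2_Cauchy_Schwarz[OF f g]
  have le: "(norm (f x + g x))\<^sup>2 \<le> ?h x" for x
    using power_mono[OF norm_triangle_ineq[of "f x" "g x"], of 2]
    by (simp add: power2_sum algebra_simps)
  have h: "integrable M ?h"
    using fi gi fg(1) by (intro Bochner_Integration.integrable_add integrable_mult_right)
  have i: "integrable M (\<lambda>x. (norm (f x + g x))\<^sup>2)"
    by (rule Bochner_Integration.integrable_bound[OF h])
      (use le in \<open>auto simp: intro!: AE_I2 order_trans[OF _ abs_ge_self]\<close>)
  then show "(\<lambda>x. f x + g x) \<in> L2 M"
    unfolding L2_def by simp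
  have "(L2_norm M (\<lambda>x. f x + g x))\<^sup>2 \<le> (LINT x|M. ?h x)"
    unfolding L2_normsq by (rule integral_mono[OF i h le])
  also have "\<dots> = (L2_norm M f)\<^sup>2 + (L2_norm M g)\<^sup>2 + 2 * (LINT x|M. norm (f x) * norm (g x))"
    using fi gi fg(1) by (simp add: L2_normsq)
  also have "\<dots> \<le> (L2_norm M f + L2_norm M g)\<^sup>2"
    using fg(2) by (simp add: power2_sum)
  finally show "L2_norm M (\<lambda>x. f x + g x) \<le> L2_norm M f + L2_norm M g"
    by (rule power2_le_imp_le) simp
qed

lemma L2_mult_bounded:
  fixes f b :: "'a \<Rightarrow> complex"
  assumes f: "f \<in> L2 M" and b[measurable]: "b \<in> borel_measurable M"
    and bd: "AE x in M. cmod (b x) \<le> K" and K: "0 \<le> K"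
  shows "(\<lambda>x. b x * f x) \<in> L2 M"
    and "L2_norm M (\<lambda>x. b x * f x) \<le> K * L2_norm M f"
proof -
  have [measurable]: "f \<in> borel_measurable M"
    and fi: "integrable M (\<lambda>x. (norm (f x))\<^sup>2)"
    using f unfolding L2_def by auto
  have le: "AE x in M. (norm (b x * f x))\<^sup>2 \<le> K\<^sup>2 * (norm (f x))\<^sup>2"
    using bd by eventually_elim
      (simp add: norm_mult power_mult_distrib mult_right_mono power_mono)
  have h: "integrable M (\<lambda>x. K\<^sup>2 * (norm (f x))\<^sup>2)"
    using fi by simp
  have i: "integrable M (\<lambda>x. (norm (b x * f x))\<^sup>2)"
    by (rule Bochner_Integration.integrable_bound[OF h]) (use le in auto)
  then show "(\<lambda>x. b x * f x) \<in> L2 M"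
    unfolding L2_def by simp
  have "(L2_norm M (\<lambda>x. b x * f x))\<^sup>2 \<le> (K * L2_norm M f)\<^sup>2"
    using integral_mono_AE[OF i h le] by (simp add: L2_normsq power_mult_distrib)
  then show "L2_norm M (\<lambda>x. b x * f x) \<le> K * L2_norm M f"
    by (rule power2_le_imp_le) (simp add: K)
qed


section \<open>Averaging over the cells of a mesh\<close>

lemma mesh_domain:
  assumes "mesh \<Omega> h \<Q>"
  shows "\<Omega> \<in> lmeasurable" "finite_measure (lebesgue_on \<Omega>)"
proof -
  have "\<Omega> = \<Union>\<Q>" "finite \<Q>" "\<And>Q. Q \<in> \<Q> \<Longrightarrow> Q \<in> lmeasurable"
    using assms unfolding mesh_def partition_on_def by auto
  then show "\<Omega> \<in> lmeasurable"
    by (simp add: fmeasurable.finite_Union subsetI)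
  then show "finite_measure (lebesgue_on \<Omega>)"
    by (rule finite_measure_lebesgue_on)
qed

text \<open>The averages are defined by integrals over the whole plane, whereas the \<open>L\<^sup>2\<close> and \<open>L\<^sup>\<infinity>\<close>
  norms refer to \<open>\<Omega>\<close> and say nothing about the values elsewhere. Since cells lie inside \<open>\<Omega>\<close>,
  everything can be expressed by integrals over \<open>\<Omega>\<close>.\<close>

lemma indicator_integral_on_mesh:
  fixes g :: "real^2 \<Rightarrow> 'b::{banach, second_countable_topology}"
  assumes mesh: "mesh \<Omega> h \<Q>" and Q: "Q \<in> \<Q>"
  shows "(LINT y:Q|lebesgue. g y) = (LINT y|lebesgue_on \<Omega>. indicat_real Q y *\<^sub>R g y)"
    and "Q \<in> sets (lebesgue_on \<Omega>)"
    and "integrable (lebesgue_on \<Omega>) (indicat_real Q)"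
    and "(LINT y|lebesgue_on \<Omega>. indicat_real Q y) = measure lebesgue Q"
proof -
  have sub: "Q \<subseteq> \<Omega>" and Qm: "Q \<in> lmeasurable"
    using mesh Q unfolding mesh_def partition_on_def by auto
  have \<Omega>: "\<Omega> \<in> sets lebesgue"
    using mesh_domain(1)[OF mesh] by auto
  have ind: "indicat_real \<Omega> y *\<^sub>R indicat_real Q y *\<^sub>R g y = indicat_real Q y *\<^sub>R g y" for y
    using sub by (auto simp: indicator_def)
  have \<Omega>': "\<Omega> \<inter> space lebesgue \<in> sets lebesgue"
    using \<Omega> by simp
  show "(LINT y:Q|lebesgue. g y) = (LINT y|lebesgue_on \<Omega>. indicat_real Q y *\<^sub>R g y)"
    unfolding set_lebesgue_integral_def integral_restrict_space[OF \<Omega>'] ind ..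
  show s: "Q \<in> sets (lebesgue_on \<Omega>)"
    using sub Qm \<Omega> by (simp add: sets_restrict_space_iff fmeasurableD)
  interpret finite_measure "lebesgue_on \<Omega>"
    by (rule mesh_domain(2)[OF mesh])
  show "integrable (lebesgue_on \<Omega>) (indicat_real Q)"
    using s by (simp add: emeasure_finite less_top[symmetric])
  have "(LINT y|lebesgue_on \<Omega>. indicat_real Q y) = measure (lebesgue_on \<Omega>) Q"
    using s sub by (simp add: Int_absorb2)
  then show "(LINT y|lebesgue_on \<Omega>. indicat_real Q y) = measure lebesgue Q"
    using \<Omega> sub by (simp add: measure_restrict_space)
qed

lemma sum_indicator_mesh:
  fixes a :: "(real^2) set \<Rightarrow> 'b::real_vector"
  assumes mesh: "mesh \<Omega> h \<Q>" and Q: "Q \<in> \<Q>" "x \<in> Q"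
  shows "(\<Sum>Q\<in>\<Q>. indicat_real Q x *\<^sub>R a Q) = a Q"
proof -
  have fin: "finite \<Q>" and dis: "\<And>R. R \<in> \<Q> \<Longrightarrow> R \<noteq> Q \<Longrightarrow> x \<notin> R"
    using mesh Q unfolding mesh_def partition_on_def disjoint_def by auto
  have "(\<Sum>Q\<in>\<Q>. indicat_real Q x *\<^sub>R a Q) = (\<Sum>R\<in>\<Q>. if R = Q then a Q else 0)"
    by (rule sum.cong) (use dis Q in \<open>auto simp: indicator_def\<close>)
  then show ?thesis
    using fin Q by simp
qed

lemma local_avg_measurable:
  assumes "mesh \<Omega> h \<Q>"
  shows "local_avg \<Q> g \<in> borel_measurable (lebesgue_on \<Omega>)"
proof -
  have [measurable]: "indicat_real Q \<in> borel_measurable (lebesgue_on \<Omega>)" if "Q \<in> \<Q>" for Q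
    using indicator_integral_on_mesh(3)[OF assms that] by auto
  show ?thesis
    unfolding local_avg_def by measurable
qed

lemma local_avg_bounded:
  assumes mesh: "mesh \<Omega> h \<Q>" and x: "x \<in> \<Omega>"
    and bd: "AE y in lebesgue_on \<Omega>. norm (g y) \<le> K" and K: "0 \<le> K"
  shows "norm (local_avg \<Q> g x) \<le> K"
proof -
  obtain Q where Q: "Q \<in> \<Q>" "x \<in> Q"
    using mesh x unfolding mesh_def partition_on_def by auto
  let ?m = "measure lebesgue Q"
  have m: "?m > 0"
    using mesh Q unfolding mesh_def by auto
  note I = indicator_integral_on_mesh[OF mesh Q(1)]
  have "norm (LINT y:Q|lebesgue. g y)
      \<le> (LINT y|lebesgue_on \<Omega>. norm (indicat_real Q y *\<^sub>R g y))"
    unfolding I(1) by (rule integral_norm_bound)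
  also have "\<dots> \<le> (LINT y|lebesgue_on \<Omega>. K * indicat_real Q y)"
  proof (rule integral_mono_AE')
    show "integrable (lebesgue_on \<Omega>) (\<lambda>y. K * indicat_real Q y)"
      using I(3) by simp
    show "AE y in lebesgue_on \<Omega>. norm (indicat_real Q y *\<^sub>R g y) \<le> K * indicat_real Q y"
      using bd by eventually_elim (auto simp: indicator_def K)
  qed (simp add: K)
  also have "\<dots> = K * ?m"
    using I(4) by (simp del: Bochner_Integration.integral_indicator)
  finally have "norm (LINT y:Q|lebesgue. g y) \<le> K * ?m" .
  then show ?thesis
    unfolding local_avg_def sum_indicator_mesh[OF mesh Q] using m by (simp add: field_simps)
qed

text \<open>Averaging is a contraction on \<open>L\<^sup>2\<close>. On one cell \<open>Q\<close>, Cauchy--Schwarz with the indicator of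
  \<open>Q\<close> as the second factor gives \<open>meas Q \<bar>a Q\<bar>\<^sup>2 \<le> \<integral>\<^sub>Q \<bar>g\<bar>\<^sup>2\<close> for the average \<open>a Q\<close> of \<open>g\<close>. Summing
  over the cells, which are disjoint and cover \<open>\<Omega>\<close>, gives the claim.\<close>

lemma local_avg_L2:
  assumes mesh: "mesh \<Omega> h \<Q>" and g: "g \<in> L2 (lebesgue_on \<Omega>)"
  shows "local_avg \<Q> g \<in> L2 (lebesgue_on \<Omega>)"
    and "L2_norm (lebesgue_on \<Omega>) (local_avg \<Q> g) \<le> L2_norm (lebesgue_on \<Omega>) g"
proof -
  let ?M = "lebesgue_on \<Omega>"
  define a where "a Q = (1 / measure lebesgue Q) *\<^sub>R (LINT y:Q|lebesgue. g y)" for Q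
  have fin: "finite \<Q>" and cover: "\<Omega> = \<Union>\<Q>"
    using mesh unfolding mesh_def partition_on_def by auto
  note I = indicator_integral_on_mesh[OF mesh]
  have gi: "integrable ?M (\<lambda>x. (norm (g x))\<^sup>2)" and gm[measurable]: "g \<in> borel_measurable ?M"
    using g unfolding L2_def by auto
  have Pg: "(norm (local_avg \<Q> g x))\<^sup>2 = (\<Sum>Q\<in>\<Q>. indicat_real Q x *\<^sub>R (norm (a Q))\<^sup>2)"
    and g_split: "(norm (g x))\<^sup>2 = (\<Sum>Q\<in>\<Q>. indicat_real Q x *\<^sub>R (norm (g x))\<^sup>2)"
    if "x \<in> space ?M" for x
  proof -
    obtain Q where Q: "Q \<in> \<Q>" "x \<in> Q"
      using \<open>x \<in> space ?M\<close> cover by auto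
    show "(norm (local_avg \<Q> g x))\<^sup>2 = (\<Sum>Q\<in>\<Q>. indicat_real Q x *\<^sub>R (norm (a Q))\<^sup>2)"
      unfolding local_avg_def sum_indicator_mesh[OF mesh Q] a_def ..
    show "(norm (g x))\<^sup>2 = (\<Sum>Q\<in>\<Q>. indicat_real Q x *\<^sub>R (norm (g x))\<^sup>2)"
      unfolding sum_indicator_mesh[OF mesh Q] ..
  qed
  have Ig: "integrable ?M (\<lambda>x. indicat_real Q x *\<^sub>R (norm (g x))\<^sup>2)" if "Q \<in> \<Q>" for Q
    by (rule integrable_mult_indicator[OF I(2)[OF that] gi])
  have cell: "measure lebesgue Q * (norm (a Q))\<^sup>2 \<le> (LINT x|?M. indicat_real Q x *\<^sub>R (norm (g x))\<^sup>2)"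
    if Q: "Q \<in> \<Q>" for Q
  proof -
    let ?m = "measure lebesgue Q" and ?f = "\<lambda>x. indicat_real Q x *\<^sub>R g x"
    have m: "?m > 0"
      using mesh Q unfolding mesh_def by auto
    have [measurable]: "indicat_real Q \<in> borel_measurable ?M"
      using I(3)[OF Q] by auto
    have sq: "(norm (indicat_real Q x))\<^sup>2 = indicat_real Q x"
      "(norm (?f x))\<^sup>2 = indicat_real Q x *\<^sub>R (norm (g x))\<^sup>2" for x
      by (auto simp: indicator_def)
    have L: "indicat_real Q \<in> L2 ?M" "?f \<in> L2 ?M"
      unfolding L2_def mem_Collect_eq sq using I(3)[OF Q] Ig[OF Q] by (blast intro: borel_measurable_integrable borel_measurable_scaleR gm)+
    have "norm (LINT y:Q|lebesgue. g y) \<le> (LINT x|?M. norm (?f x))"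
      unfolding I(1)[OF Q] by (rule integral_norm_bound)
    also have "(\<lambda>x. norm (?f x)) = (\<lambda>x. norm (indicat_real Q x) * norm (?f x))"
      by (auto simp: indicator_def)
    also have "(LINT x|?M. \<dots> x) \<le> L2_norm ?M (indicat_real Q) * L2_norm ?M ?f"
      by (rule L2_Cauchy_Schwarz(2)[OF L])
    finally have "(norm (LINT y:Q|lebesgue. g y))\<^sup>2 \<le> (L2_norm ?M (indicat_real Q) * L2_norm ?M ?f)\<^sup>2"
      by (rule power_mono) simp
    also have "\<dots> = ?m * (LINT x|?M. indicat_real Q x *\<^sub>R (norm (g x))\<^sup>2)"
      unfolding power_mult_distrib L2_normsq sq I(4)[OF Q] ..
    finally show ?thesis
      using m by (simp add: a_def power_mult_distrib power_divide field_simps power2_eq_square)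
  qed
  have Ia: "integrable ?M (\<lambda>x. \<Sum>Q\<in>\<Q>. indicat_real Q x *\<^sub>R (norm (a Q))\<^sup>2)"
    using I(3) by (intro Bochner_Integration.integrable_sum) simp
  then have "integrable ?M (\<lambda>x. (norm (local_avg \<Q> g x))\<^sup>2)"
    by (subst Bochner_Integration.integrable_cong[OF refl Pg])
  then show "local_avg \<Q> g \<in> L2 ?M"
    unfolding L2_def using local_avg_measurable[OF mesh] by auto
  have "(L2_norm ?M (local_avg \<Q> g))\<^sup>2 = (LINT x|?M. (\<Sum>Q\<in>\<Q>. indicat_real Q x *\<^sub>R (norm (a Q))\<^sup>2))"
    unfolding L2_normsq by (rule Bochner_Integration.integral_cong[OF refl Pg])
  also have "\<dots> = (\<Sum>Q\<in>\<Q>. measure lebesgue Q * (norm (a Q))\<^sup>2)"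
    using I(3,4) by (subst Bochner_Integration.integral_sum) auto
  also have "\<dots> \<le> (\<Sum>Q\<in>\<Q>. LINT x|?M. indicat_real Q x *\<^sub>R (norm (g x))\<^sup>2)"
    by (rule sum_mono[OF cell])
  also have "\<dots> = (LINT x|?M. (\<Sum>Q\<in>\<Q>. indicat_real Q x *\<^sub>R (norm (g x))\<^sup>2))"
    using Ig by (subst Bochner_Integration.integral_sum) auto
  also have "\<dots> = (L2_norm ?M g)\<^sup>2"
    unfolding L2_normsq by (rule Bochner_Integration.integral_cong[OF refl g_split, symmetric])
  finally show "L2_norm ?M (local_avg \<Q> g) \<le> L2_norm ?M g"
    by (rule power2_le_imp_le) simp
qed


section \<open>The energy estimate\<close>

text \<open>The gradient term of the tested equation is real and the boundary term is purely imaginary, so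
  neither can cancel the other. The factor \<open>1 / \<surd>2\<close> comes from \<open>a + b \<le> \<surd>2 \<surd>(a\<^sup>2 + b\<^sup>2)\<close>.\<close>

lemma cmod_ge_sum_parts:
  fixes A B k s :: real
  assumes "0 \<le> A" "0 \<le> B" "0 < k" "s \<in> {1, -1}"
  shows "min k 1 / sqrt 2 * (A + B) \<le> cmod (of_real A - of_real s * \<i> * of_real k * of_real B)"
proof -
  have "min k 1 * A \<le> 1 * A" "min k 1 * B \<le> k * B"
    using assms by (intro mult_right_mono; simp)+
  then have "min k 1 * (A + B) \<le> A + k * B"
    by (simp add: distrib_left)
  also have "\<dots> \<le> sqrt (2 * (A\<^sup>2 + (k * B)\<^sup>2))"
    by (rule real_le_rsqrt)
      (use sum_squares_bound[of A "k * B"] in \<open>simp add: power2_sum\<close>)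
  also have "\<dots> = sqrt 2 * cmod (of_real A - of_real s * \<i> * of_real k * of_real B)"
    using assms(4) by (auto simp: cmod_def simp flip: real_sqrt_mult)
  finally show ?thesis
    by (simp add: divide_le_eq mult.commute)
qed

text \<open>Tested with \<open>y\<close> itself, the boundary term becomes \<open>\<i> k\<close> times a squared norm directly, because
  the same chosen trace occurs in both factors. By the previous lemma, the modulus then controls the
  sum of the gradient and boundary energies, and the Friedrichs inequality bounds that sum below by
  the full \<open>H\<^sup>1\<close> norm.\<close>

lemma robin_helmholtz_energy:
  assumes friedrichs: "friedrichs_constant \<Omega> S lam"
    and y: "robin_helmholtz_solution \<Omega> S s k g y"
    and g: "g \<in> L2 (lebesgue_on \<Omega>)" and k: "k > 0" and s: "s \<in> {1, -1}"
  shows "min k 1 / sqrt 2 * lam * (H1_norm \<Omega> y)\<^sup>2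
    \<le> k\<^sup>2 * (L2_norm (lebesgue_on \<Omega>) y)\<^sup>2
      + L2_norm (lebesgue_on \<Omega>) g * L2_norm (lebesgue_on \<Omega>) y"
proof -
  let ?M = "lebesgue_on \<Omega>"
  define A where "A = (L2_norm ?M (weak_grad \<Omega> y))\<^sup>2"
  define B where "B = (L2_norm S (bdry_trace \<Omega> S y))\<^sup>2"
  define U where "U = L2_norm ?M y"
  have yH: "y \<in> H1 \<Omega>" and yL: "y \<in> L2 ?M" and lam: "lam > 0"
    using y friedrichs unfolding robin_helmholtz_solution_def H1_def friedrichs_constant_def by auto
  have grad: "(\<Sum>i\<in>UNIV. v $ i * cnj (v $ i)) = of_real ((norm v)\<^sup>2)" for v :: "complex^2"
    by (simp add: norm_vec_def L2_set_def sum_nonneg complex_norm_square del: of_real_power)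
  have "of_real A - of_real (k\<^sup>2) * of_real (U\<^sup>2) - of_real s * \<i> * of_real k * of_real B
      = (LINT x|?M. g x * cnj (y x))"
    using bspec[OF conjunct2[OF y[unfolded robin_helmholtz_solution_def]] yH]
    unfolding grad unfolding A_def B_def U_def L2_normsq complex_norm_square[symmetric]
      integral_complex_of_real .
  then have "cmod (of_real A - of_real s * \<i> * of_real k * of_real B)
      = cmod ((LINT x|?M. g x * cnj (y x)) + of_real (k\<^sup>2 * U\<^sup>2))"
    by (simp add: algebra_simps)
  also have "\<dots> \<le> L2_norm ?M g * U + k\<^sup>2 * U\<^sup>2"
    using norm_triangle_ineq[of "LINT x|?M. g x * cnj (y x)" "of_real (k\<^sup>2 * U\<^sup>2)"]
      L2_mult_cnj(2)[OF g yL]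
    unfolding U_def norm_of_real by simp
  finally have bound: "min k 1 / sqrt 2 * (A + B) \<le> k\<^sup>2 * U\<^sup>2 + L2_norm ?M g * U"
    using cmod_ge_sum_parts[of A B k s] k s unfolding A_def B_def by simp
  have "sqrt lam * H1_norm \<Omega> y \<le> sqrt (B + A)"
    using friedrichs yH unfolding friedrichs_constant_def A_def B_def by auto
  then have "(sqrt lam * H1_norm \<Omega> y)\<^sup>2 \<le> (sqrt (B + A))\<^sup>2"
    by (rule power_mono) (use lam in \<open>simp add: H1_norm_def\<close>)
  then have "lam * (H1_norm \<Omega> y)\<^sup>2 \<le> A + B"
    using lam by (simp add: power_mult_distrib A_def B_def)
  then have "min k 1 / sqrt 2 * (lam * (H1_norm \<Omega> y)\<^sup>2) \<le> min k 1 / sqrt 2 * (A + B)"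
    by (rule mult_left_mono) (use k in simp)
  with bound show ?thesis
    unfolding U_def by (simp add: mult.assoc)
qed

section \<open>The uniform bound\<close>

theorem proposition4p13:
  fixes \<Omega> \<Omega>' :: "(real^2) set" and S :: "(real^2) measure"
    and C c3 lam h wl wu qt k0 c1 cb cb2 :: real
    and d :: "real^2"
    and \<Q> :: "(real^2) set set"
    and q w :: "real^2 \<Rightarrow> real"
    and u0 uh :: "real^2 \<Rightarrow> complex"
  assumes square: "square_with_boundary \<Omega> S"
    and friedrichs: "friedrichs_constant \<Omega> S lam"
    and regularity: "H2_regularity_constant \<Omega> S C"
    and embedding: "H2_Linf_embedding_constant \<Omega> c3"
    and mesh: "mesh \<Omega> h \<Q>"
    and subdomain: "\<Omega>' \<in> sets lebesgue" "\<Omega>' \<subseteq> \<Omega>"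
    and compatible: "\<exists>\<J> \<subseteq> \<Q>. \<Omega>' = \<Union>\<J>"
    and q: "q = (\<lambda>x. qt * indicat_real \<Omega>' x)"
    and u0: "u0 = (\<lambda>x. exp (\<i> * of_real (k0 * (d \<bullet> x))))"
    and c1: "c1 = C * (1 + \<bar>k0\<bar>) * k0\<^sup>2 * qt * max (- wl) wu"
    and cb: "cb = lam * min k0 1 / sqrt 2 - k0\<^sup>2 * (1 + qt * max (- wl) wu)"
    and cb2: "cb2 = inverse cb * k0\<^sup>2 * qt * max (- wl) wu"
    and bounds: "wl < wu" "qt > 0" "k0 > 0"
    and small: "min k0 1 / sqrt 2 * lam > k0\<^sup>2 * (1 + qt * max (- wl) wu)"
    and w: "w \<in> W_ad \<Omega> wl wu"
    and uh: "uh \<in> H1 \<Omega>"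
    and uh_eq: "\<forall>v \<in> H1 \<Omega>.
      (LINT x|lebesgue_on \<Omega>. (\<Sum>i\<in>UNIV. weak_grad \<Omega> uh x $ i * cnj (weak_grad \<Omega> v x $ i)))
      - of_real (k0\<^sup>2) * (LINT x|lebesgue_on \<Omega>. uh x * cnj (v x))
      - of_real (k0\<^sup>2) * (LINT x|lebesgue_on \<Omega>.
          of_real (q x) * of_real (local_avg \<Q> w x) * local_avg \<Q> uh x * cnj (v x))
      - \<i> * of_real k0 * (LINT x|S. bdry_trace \<Omega> S uh x * cnj (bdry_trace \<Omega> S v x))
      = of_real (k0\<^sup>2) * (LINT x|lebesgue_on \<Omega>.
          of_real (q x) * of_real (w x) * u0 x * cnj (v x))"
  shows "Linf_norm (lebesgue_on \<Omega>) uh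
    \<le> ereal (sqrt 2 * c3 * (c1 + c1 * cb2 + cb2) * L2_norm (lebesgue_on \<Omega>) u0)"
proof -
  let ?M = "lebesgue_on \<Omega>"
  define m where "m = max (- wl) wu"
  define K where "K = qt * m"
  define f1 where "f1 x = of_real (q x) * of_real (local_avg \<Q> w x) * local_avg \<Q> uh x" for x
  define f2 where "f2 x = of_real (q x) * of_real (w x) * u0 x" for x
  define g where "g x = of_real (k0\<^sup>2) * (f1 x + f2 x)" for x
  define U where "U = L2_norm ?M uh"
  define N where "N = L2_norm ?M u0"
  define X where "X = H1_norm \<Omega> uh"
  define Y where "Y = H2_seminorm \<Omega> uh"
  have m: "m > 0" and K: "K \<ge> 0"
    using bounds unfolding m_def K_def by auto
  have NU: "N \<ge> 0" "U \<ge> 0"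
    unfolding N_def U_def by auto
  have uL: "uh \<in> L2 ?M"
    using uh unfolding H1_def by auto
  have UX: "U \<le> X" and X: "X \<ge> 0"
    unfolding U_def X_def H1_norm_def by (auto intro: real_le_rsqrt)

  have qm [measurable]: "q \<in> borel_measurable ?M"
    unfolding q using subdomain by (intro measurable_restrict_space1 borel_measurable_times borel_measurable_indicator) auto
  have wm [measurable]: "w \<in> borel_measurable ?M" and wb: "AE x in ?M. norm (w x) \<le> m"
    using w unfolding W_ad_def Linf_def m_def by auto
  note [measurable] = local_avg_measurable[OF mesh, of w]
  have qb: "\<bar>q x\<bar> \<le> qt" for x
    using bounds unfolding q by (auto simp: indicator_def)
  have u0L: "u0 \<in> L2 ?M"
  proof -
    interpret finite_measure ?M
      by (rule mesh_domain(2)[OF mesh])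
    have "u0 \<in> borel_measurable lebesgue"
      unfolding u0 by (intro borel_measurable_continuous_onI continuous_intros measurable_completion)
        (simp_all)
    then have "u0 \<in> borel_measurable ?M"
      by (rule measurable_restrict_space1)
    then show ?thesis
      unfolding L2_def by (simp add: u0 norm_exp)
  qed
  have f1: "f1 \<in> L2 ?M" "L2_norm ?M f1 \<le> K * U"
  proof -
    have b: "AE x in ?M. cmod (of_real (q x) * of_real (local_avg \<Q> w x)) \<le> K"
      using local_avg_bounded[OF mesh _ wb] qb m bounds unfolding K_def
      by (intro AE_I2) (auto simp: norm_mult intro!: mult_mono)
    note B = L2_mult_bounded[OF local_avg_L2(1)[OF mesh uL] _ b K]
    show "f1 \<in> L2 ?M"
      unfolding f1_def by (rule B) measurable
    have "L2_norm ?M f1 \<le> K * L2_norm ?M (local_avg \<Q> uh)"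
      unfolding f1_def by (rule B) measurable
    also have "\<dots> \<le> K * U"
      unfolding U_def by (rule mult_left_mono[OF local_avg_L2(2)[OF mesh uL] K])
    finally show "L2_norm ?M f1 \<le> K * U" .
  qed
  have f2: "f2 \<in> L2 ?M" "L2_norm ?M f2 \<le> K * N"
  proof -
    have b: "AE x in ?M. cmod (of_real (q x) * of_real (w x)) \<le> K"
      using wb by eventually_elim
        (use qb bounds in \<open>auto simp: norm_mult K_def intro!: mult_mono\<close>)
    note B = L2_mult_bounded[OF u0L _ b K]
    show "f2 \<in> L2 ?M"
      unfolding f2_def by (rule B) measurable
    show "L2_norm ?M f2 \<le> K * N"
      unfolding f2_def N_def by (rule B) measurable
  qed
  note f12 = L2_add[OF f1(1) f2(1)]
  have gL: "g \<in> L2 ?M" and g: "L2_norm ?M g \<le> k0\<^sup>2 * K * (U + N)"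
  proof -
    note B = L2_mult_bounded[OF f12(1), of "\<lambda>_. of_real (k0\<^sup>2)" "k0\<^sup>2"]
    show "g \<in> L2 ?M"
      unfolding g_def by (rule B) (auto simp: norm_power)
    have "L2_norm ?M g \<le> k0\<^sup>2 * L2_norm ?M (\<lambda>x. f1 x + f2 x)"
      unfolding g_def by (rule B) (auto simp: norm_power)
    also have "\<dots> \<le> k0\<^sup>2 * (K * U + K * N)"
      by (rule mult_left_mono) (use f12(2) f1(2) f2(2) in auto)
    finally show "L2_norm ?M g \<le> k0\<^sup>2 * K * (U + N)"
      by (simp add: algebra_simps)
  qed

  have sol: "robin_helmholtz_solution \<Omega> S 1 k0 g uh"
    unfolding robin_helmholtz_solution_def
  proof (intro conjI ballI uh)
    fix v assume v: "v \<in> H1 \<Omega>"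
    then have vL: "v \<in> L2 ?M"
      unfolding H1_def by auto
    have "(LINT x|?M. g x * cnj (v x))
        = (LINT x|?M. of_real (k0\<^sup>2) * (f1 x * cnj (v x)) + of_real (k0\<^sup>2) * (f2 x * cnj (v x)))"
      unfolding g_def by (simp add: algebra_simps)
    also have "\<dots> = of_real (k0\<^sup>2) * (LINT x|?M. f1 x * cnj (v x))
        + of_real (k0\<^sup>2) * (LINT x|?M. f2 x * cnj (v x))"
      using L2_mult_cnj(1)[OF f1(1) vL] L2_mult_cnj(1)[OF f2(1) vL] by simp
    finally show "(LINT x|?M. (\<Sum>i\<in>UNIV. weak_grad \<Omega> uh x $ i * cnj (weak_grad \<Omega> v x $ i)))
        - of_real (k0\<^sup>2) * (LINT x|?M. uh x * cnj (v x))
        - of_real 1 * \<i> * of_real k0 * (LINT x|S. bdry_trace \<Omega> S uh x * cnj (bdry_trace \<Omega> S v x))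
        = (LINT x|?M. g x * cnj (v x))"
      using uh_eq[rule_format, OF v] unfolding f1_def f2_def by (simp add: algebra_simps)
  qed

  \<comment> \<open>The \<open>L\<^sup>2\<close> norm of \<open>g\<close> involves \<open>U\<close>; the bound on \<open>X\<close> turns it into a bound by \<open>N\<close> alone.\<close>
  have H1_bound: "X \<le> cb2 * N"
  proof -
    have "min k0 1 / sqrt 2 * lam * X\<^sup>2 \<le> k0\<^sup>2 * U\<^sup>2 + L2_norm ?M g * U"
      using robin_helmholtz_energy[OF friedrichs sol gL bounds(3)] unfolding X_def U_def by simp
    also have "\<dots> \<le> k0\<^sup>2 * U\<^sup>2 + k0\<^sup>2 * K * (U + N) * U"
      using g NU by (simp add: mult_right_mono)
    also have "\<dots> \<le> k0\<^sup>2 * X\<^sup>2 + k0\<^sup>2 * K * (X + N) * X"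
      using UX NU X K bounds(3) by (intro add_mono mult_mono power_mono) auto
    \<comment> \<open>Here \<open>cb\<close> is what remains of the coercivity constant after the quadratic terms are absorbed.\<close>
    finally have "(cb * X) * X \<le> (k0\<^sup>2 * K * N) * X"
      unfolding cb K_def m_def by (simp add: power2_eq_square algebra_simps)
    then have "cb * X \<le> k0\<^sup>2 * K * N"
      using X K NU by (cases "X = 0") auto
    moreover have "cb > 0"
      using small unfolding cb by (simp add: algebra_simps)
    ultimately show ?thesis
      unfolding cb2 K_def m_def by (simp add: field_simps)
  qed
  have c1_nonneg: "c1 \<ge> 0" and C: "C > 0"
    using regularity bounds m unfolding H2_regularity_constant_def c1 m_def by auto
  have uH2: "uh \<in> H2 \<Omega>" and "Y \<le> C * (1 + \<bar>k0\<bar>) * L2_norm ?M g"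
    using regularity bounds(3) gL sol unfolding H2_regularity_constant_def Y_def by auto
  note this(2)
  also have "\<dots> \<le> C * (1 + \<bar>k0\<bar>) * (k0\<^sup>2 * K * (U + N))"
    by (rule mult_left_mono[OF g]) (use C in simp)
  also have "\<dots> = c1 * (U + N)"
    unfolding c1 K_def m_def by simp
  also have "\<dots> \<le> c1 * (cb2 * N + N)"
    using UX H1_bound c1_nonneg by (intro mult_left_mono) auto
  finally have H2_bound: "Y \<le> c1 * (cb2 * N + N)" .

  have c3: "c3 > 0" and "Linf_norm ?M uh \<le> ereal (c3 * H2_norm \<Omega> uh)"
    using embedding uH2 unfolding H2_Linf_embedding_constant_def by auto
  note this(2)
  also have "c3 * H2_norm \<Omega> uh \<le> c3 * ((c1 + c1 * cb2 + cb2) * N)"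
  proof (rule mult_left_mono)
    have "Y \<ge> 0"
      unfolding Y_def H2_seminorm_def by (simp add: sum_nonneg)
    then have "H2_norm \<Omega> uh \<le> X + Y"
      unfolding H2_norm_def X_def[symmetric] Y_def[symmetric] using X
      by (rule sqrt_sum_squares_le_sum[rotated])
    also have "\<dots> \<le> (c1 + c1 * cb2 + cb2) * N"
      using H1_bound H2_bound by (simp add: algebra_simps)
    finally show "H2_norm \<Omega> uh \<le> (c1 + c1 * cb2 + cb2) * N" .
    then show "0 \<le> c3" using c3 by simp
  qed
  also have "\<dots> \<le> sqrt 2 * (c3 * ((c1 + c1 * cb2 + cb2) * N))"
  proof -
    have "0 \<le> c3 * H2_norm \<Omega> uh"
      using c3 unfolding H2_norm_def by simp
    with \<open>c3 * H2_norm \<Omega> uh \<le> _\<close> have "1 * (c3 * ((c1 + c1 * cb2 + cb2) * N))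
        \<le> sqrt 2 * (c3 * ((c1 + c1 * cb2 + cb2) * N))"
      by (intro mult_right_mono) auto
    then show ?thesis by simp
  qed
  finally show ?thesis
    unfolding N_def by (simp add: mult.assoc)
qed

end
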